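(* Let $w\in A_{n-1}$ be a fully commutative involution, let $\gamma$ be the walk of length $n$ attached to $w$ through its heap, and let $\beta$ be the Dyck-path prefix of length $n$ attached to $w$ through the Robinson--Schensted correspondence. Then $\beta$ is obtained from $\gamma$ by replacing in $\gamma$ all horizontal steps by ascending ones.
   Context: $A_{n-1}$ is the symmetric group on $\{1,\dots,n\}$ with Coxeter generators $s_i=(i\ i{+}1)$, $1\le i\le n-1$. An element is fully commutative (FC) if any reduced expression of it can be obtained from any other using only commutation relations $s_is_j=s_js_i$, $|i-j|\ge2$; equivalently the permutation avoids the pattern $321$. Involutions satisfy $w^2=1$ (identity included). Walk $\gamma$: for $w$ an FC involution let $h_i$ be the number of occurrences of $s_i$ in any reduced expression of $w$ (this is the number $|H_{s_i}|$ of elements labelled $s_i$ in the heap $H$ of $w$, and is independent of the reduced expression), and put $h_0=h_n=0$. Then $\gamma=(P_0,\dots,P_n)$ with $P_i=(i,h_i)$. It is a walk from $(0,0)$ to $(n,0)$ with steps in $\{(1,1),(1,-1),(1,0)\}$ (ascending, descending, horizontal), whose horizontal steps only occur on the $x$-axis. Walk $\beta$: let $T$ be the standard Young tableau associated to the involution $w$ by the Robinson--Schensted correspondence (row insertion of $w(1),w(2),\dots,w(n)$; the insertion and recording tableaux coincide as $w$ is an involution). Since $w$ avoids $321$, $T$ has at most two rows. Then $\beta$ is the path of length $n$ starting at $(0,0)$ whose $i$th step is ascending, $(1,1)$, if $i$ lies in the first row of $T$, and descending, $(1,-1)$, if $i$ lies in the second row. "Replacing horizontal steps by ascending ones" means changing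 these steps in the sequence of steps of the walk, the other steps being kept unchanged (and translated accordingly). *)

theory Defs
  imports "HOL-Combinatorics.Permutations" "HOL-Library.Product_Plus"
begin

text \<open>
  The Coxeter group of type A with n - 1 generators is realised as the set of permutations of
  \<^term>\<open>{1..n::nat}\<close>. Words in the generators are lists of indices in \<^term>\<open>{1..<n::nat}\<close>; products
  are compositions of functions, so the rightmost letter acts first.
\<close>

definition gen :: "nat \<Rightarrow> nat \<Rightarrow> nat" where
  "gen i = transpose i (Suc i)"

definition word_prod :: "nat list \<Rightarrow> nat \<Rightarrow> nat" where
  "word_prod r = foldr (\<lambda>i p. gen i \<circ> p) r id"

definition expression :: "nat \<Rightarrow> (nat \<Rightarrow> nat) \<Rightarrow> nat list \<Rightarrow> bool" where
  "expression n w r \<longleftrightarrow> set r \<subseteq> {1..<n} \<and> word_prod r = w"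

definition reduced_expression :: "nat \<Rightarrow> (nat \<Rightarrow> nat) \<Rightarrow> nat list \<Rightarrow> bool" where
  "reduced_expression n w r \<longleftrightarrow>
     expression n w r \<and> (\<forall>r'. expression n w r' \<longrightarrow> length r \<le> length r')"

inductive commutation :: "nat list \<Rightarrow> nat list \<Rightarrow> bool" where
  "i + 2 \<le> j \<or> j + 2 \<le> i \<Longrightarrow> commutation (xs @ [i, j] @ ys) (xs @ [j, i] @ ys)"

definition fully_commutative :: "nat \<Rightarrow> (nat \<Rightarrow> nat) \<Rightarrow> bool" where
  "fully_commutative n w \<longleftrightarrow>
     (\<forall>r r'. reduced_expression n w r \<longrightarrow> reduced_expression n w r' \<longrightarrow> commutation\<^sup>*\<^sup>* r r')"

text \<open>A walk is the list of the points it visits.\<close>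

type_synonym walk = "(int \<times> int) list"

definition walk_steps :: "walk \<Rightarrow> (int \<times> int) list" where
  "walk_steps P = map2 (\<lambda>p q. q - p) (butlast P) (tl P)"

fun walk_from :: "int \<times> int \<Rightarrow> (int \<times> int) list \<Rightarrow> walk" where
  "walk_from p [] = [p]"
| "walk_from p (s # ss) = p # walk_from (p + s) ss"

definition replace_horizontal_by_ascending :: "walk \<Rightarrow> walk" where
  "replace_horizontal_by_ascending P =
     walk_from (hd P) (map (\<lambda>s. if s = (1, 0) then (1, 1) else s) (walk_steps P))"

text \<open>
  The definite description expresses that the number of occurrences of a generator is the same
  in all reduced expressions; this holds for fully commutative elements, and the value is then
  the number of elements of the heap with that label.
\<close>

definition occurrences :: "nat \<Rightarrow> (nat \<Rightarrow> nat) \<Rightarrow> nat \<Rightarrow> nat" where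
  "occurrences n w i = (THE k. \<forall>r. reduced_expression n w r \<longrightarrow> count_list r i = k)"

definition heap_height :: "nat \<Rightarrow> (nat \<Rightarrow> nat) \<Rightarrow> nat \<Rightarrow> nat" where
  "heap_height n w i = (if 1 \<le> i \<and> i < n then occurrences n w i else 0)"

definition gamma_walk :: "nat \<Rightarrow> (nat \<Rightarrow> nat) \<Rightarrow> walk" where
  "gamma_walk n w = map (\<lambda>i. (int i, int (heap_height n w i))) [0..<Suc n]"

text \<open>
  A tableau is the list of its rows. Inserting an entry in a row replaces the leftmost larger
  entry, which is bumped to the next row; if there is none, the new entry is appended.
\<close>

fun row_insert :: "nat \<Rightarrow> nat list \<Rightarrow> nat list \<times> nat option" where
  "row_insert x [] = ([x], None)"
| "row_insert x (y # ys) =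
     (if x < y then (x # ys, Some y)
      else (let (zs, b) = row_insert x ys in (y # zs, b)))"

fun tableau_insert :: "nat \<Rightarrow> nat list list \<Rightarrow> nat list list" where
  "tableau_insert x [] = [[x]]"
| "tableau_insert x (r # rs) =
     (case row_insert x r of
        (r', None) \<Rightarrow> r' # rs
      | (r', Some y) \<Rightarrow> r' # tableau_insert y rs)"

text \<open>
  This is the insertion tableau; for an involution the recording tableau is the same.
\<close>

definition RS_tableau :: "nat \<Rightarrow> (nat \<Rightarrow> nat) \<Rightarrow> nat list list" where
  "RS_tableau n w = fold tableau_insert (map w [1..<Suc n]) []"

definition in_row :: "nat list list \<Rightarrow> nat \<Rightarrow> nat \<Rightarrow> bool" where
  "in_row T k i \<longleftrightarrow> 1 \<le> k \<and> k \<le> length T \<and> i \<in> set (T ! (k - 1))"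

text \<open>
  The tableau of a 321-avoiding permutation has at most two rows, so the last branch does not
  occur for fully commutative elements.
\<close>

definition beta_step :: "nat \<Rightarrow> (nat \<Rightarrow> nat) \<Rightarrow> nat \<Rightarrow> int \<times> int" where
  "beta_step n w i =
     (if in_row (RS_tableau n w) 1 i then (1, 1)
      else if in_row (RS_tableau n w) 2 i then (1, -1)
      else undefined)"

definition beta_walk :: "nat \<Rightarrow> (nat \<Rightarrow> nat) \<Rightarrow> walk" where
  "beta_walk n w = walk_from (0, 0) (map (beta_step n w) [1..<Suc n])"

end

theory Submission
  imports Defs
begin

text \<open>
  For w avoiding 321, the height of the heap over k is the number of positions j \<le> k with
  w(j) > k, since a descent of w at i always exchanges a value above i with a value at most i.
  For an involution the steps of \<open>\<gamma>\<close> are therefore ascending at the i with w(i) > i, descending at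
  those with w(i) < i, and horizontal at the fixed points. On the tableau side, row insertion
  bumps exactly the i with w(i) < i into the second row.
\<close>

section \<open>Reduced expressions and inversions\<close>

definition inversions :: "(nat \<Rightarrow> nat) \<Rightarrow> (nat \<times> nat) set" where
  "inversions w = {(a, b). a < b \<and> w b < w a}"

lemma inversions_id [simp]: "inversions id = {}"
  by (auto simp: inversions_def)

section \<open>Adjacent transpositions and words in them\<close>

lemma gen_simps [simp]: "gen i i = Suc i" "gen i (Suc i) = i"
  by (simp_all add: gen_def)

lemma gen_other: "a \<noteq> i \<Longrightarrow> a \<noteq> Suc i \<Longrightarrow> gen i a = a"
  by (simp add: gen_def transpose_def)

lemma gen_gen [simp]: "gen i (gen i a) = a"
  by (simp add: gen_def)

lemma comp_gen_gen [simp]: "w \<circ> gen i \<circ> gen i = w"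
  by (simp add: fun_eq_iff)

text \<open>No number lies between \<open>i\<close> and \<open>Suc i\<close>, so exchanging them
  alters the relative order of that pair only.\<close>

lemma gen_less: "a < b \<Longrightarrow> a \<noteq> i \<or> b \<noteq> Suc i \<Longrightarrow> gen i a < gen i b"
  by (auto simp: gen_def transpose_def)

lemma gen_le_iff: "k \<noteq> i \<Longrightarrow> gen i a \<le> k \<longleftrightarrow> a \<le> k"
  by (auto simp: gen_def transpose_def)

lemma gen_permutes: "i \<in> {1..<n} \<Longrightarrow> gen i permutes {1..n}"
  unfolding gen_def by (rule permutes_swap_id) auto

lemma permutes_comp_gen: "w permutes {1..n} \<Longrightarrow> i \<in> {1..<n} \<Longrightarrow> w \<circ> gen i permutes {1..n}"
  by (intro permutes_compose gen_permutes)

lemma word_prod_simps [simp]: "word_prod [] = id" "word_prod (i # r) = gen i \<circ> word_prod r"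
  by (simp_all add: word_prod_def)

lemma word_prod_append: "word_prod (r @ s) = word_prod r \<circ> word_prod s"
  by (induction r) (simp_all add: o_assoc)

lemma word_prod_permutes: "set r \<subseteq> {1..<n} \<Longrightarrow> word_prod r permutes {1..n}"
proof (induction r)
  case (Cons i r)
  then show ?case unfolding word_prod_simps by (intro permutes_compose gen_permutes) auto
qed (simp add: permutes_id)

section \<open>Counting inversions\<close>

lemma permutes_interval_eq_iff:
  fixes w :: "nat \<Rightarrow> nat"
  shows "w permutes {1..n} \<Longrightarrow> w a = w b \<longleftrightarrow> a = b"
  by (meson permutes_inj injD)

text \<open>\<open>inversions\<close> ranges over all naturals, but the fixed points outside
  \<open>{1..n}\<close> create none. Hence the set is finite, and every descent sits at the index of
  a generator.\<close>

lemma inversion_bounds: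
  fixes w :: "nat \<Rightarrow> nat"
  assumes w: "w permutes {1..n}" and ab: "a < b" "w b < w a"
  shows "1 \<le> a" "b \<le> n"
proof -
  have out: "x \<notin> {1..n} \<Longrightarrow> w x = x" for x using w by (simp add: permutes_def)
  show "1 \<le> a" using out[of a] ab by (cases a) auto
  show "b \<le> n"
  proof (rule ccontr)
    assume "\<not> b \<le> n"
    then have "w b = b" "n < b" using out[of b] by auto
    then have "w a \<notin> {1..n}" using ab by auto
    then have "a \<notin> {1..n}" using permutes_in_image[OF w] by blast
    then show False using out[of a] \<open>w b = b\<close> ab by simp
  qed
qed

lemma finite_inversions:
  assumes "w permutes {1..n}"
  shows "finite (inversions w)"
proof (rule finite_subset)
  show "inversions w \<subseteq> {1..n} \<times> {1..n}"
    using inversion_bounds[OF assms] by (fastforce simp: inversions_def)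
qed simp

text \<open>By \<open>gen_less\<close>, relabelling positions by \<open>gen i\<close> keeps the
  order within every inverted pair; the one new inversion is the ascent turned into a
  descent.\<close>

lemma inversions_comp_gen:
  assumes "w i < w (Suc i)"
  shows "inversions (w \<circ> gen i) = insert (i, Suc i) (map_prod (gen i) (gen i) ` inversions w)"
proof (intro set_eqI iffI)
  fix x assume "x \<in> inversions (w \<circ> gen i)"
  then obtain a b where x: "x = (a, b)" "a < b" "w (gen i b) < w (gen i a)"
    by (auto simp: inversions_def)
  show "x \<in> insert (i, Suc i) (map_prod (gen i) (gen i) ` inversions w)"
  proof (cases "a = i \<and> b = Suc i")
    case False
    then have "(gen i a, gen i b) \<in> inversions w" using x gen_less by (auto simp: inversions_def)
    then show ?thesis using x(1) by (force simp: image_iff)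
  qed (simp add: x)
next
  fix x assume "x \<in> insert (i, Suc i) (map_prod (gen i) (gen i) ` inversions w)"
  then consider "x = (i, Suc i)"
    | a b where "x = (gen i a, gen i b)" "a < b" "w b < w a"
    by (auto simp: inversions_def)
  then show "x \<in> inversions (w \<circ> gen i)"
  proof cases
    case 2
    then have "a \<noteq> i \<or> b \<noteq> Suc i" using assms by auto
    then show ?thesis using 2 gen_less by (auto simp: inversions_def)
  qed (use assms in \<open>simp add: inversions_def\<close>)
qed

lemma card_inversions_ascent:
  assumes "w permutes {1..n}" "w i < w (Suc i)"
  shows "card (inversions (w \<circ> gen i)) = Suc (card (inversions w))"
proof -
  have inj: "inj (map_prod (gen i) (gen i))"
    by (intro prod.inj_map) (metis gen_gen injI)+
  have "(i, Suc i) \<notin> map_prod (gen i) (gen i) ` inversions w"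
  proof
    assume "(i, Suc i) \<in> map_prod (gen i) (gen i) ` inversions w"
    then obtain a b where "i = gen i a" "Suc i = gen i b" "a < b"
      by (auto simp: inversions_def)
    then have "a = Suc i" "b = i" by (metis gen_gen gen_simps)+
    then show False using \<open>a < b\<close> by simp
  qed
  then show ?thesis
    by (simp add: inversions_comp_gen[OF assms(2)] finite_inversions[OF assms(1)]
        card_image[OF inj_on_subset[OF inj]])
qed

lemma card_inversions_descent:
  assumes "w permutes {1..n}" "i \<in> {1..<n}" "w (Suc i) < w i"
  shows "card (inversions w) = Suc (card (inversions (w \<circ> gen i)))"
  using card_inversions_ascent[OF permutes_comp_gen[OF assms(1,2)], of i] assms(3) by simp

text \<open>Each letter changes the number of inversions by exactly one, up or down.\<close>

lemma card_inversions_word_prod: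
  "set r \<subseteq> {1..<n} \<Longrightarrow> card (inversions (word_prod r)) \<le> length r"
proof (induction r rule: rev_induct)
  case Nil
  show ?case unfolding word_prod_simps inversions_id by simp
next
  case (snoc i r)
  let ?u = "word_prod r"
  have u: "?u permutes {1..n}" and i: "i \<in> {1..<n}" using snoc.prems word_prod_permutes by auto
  have IH: "card (inversions ?u) \<le> length r" using snoc by simp
  consider "?u i < ?u (Suc i)" | "?u (Suc i) < ?u i"
    using permutes_interval_eq_iff[OF u, of i "Suc i"] by linarith
  then have "card (inversions (?u \<circ> gen i)) \<le> Suc (length r)"
    using card_inversions_ascent[OF u, of i] card_inversions_descent[OF u i] IH
    by cases linarith+
  moreover have "word_prod (r @ [i]) = ?u \<circ> gen i" by (simp add: word_prod_append)
  ultimately show ?case by (simp only: length_append_singleton)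
qed

text \<open>Without descents \<open>w\<close> is strictly increasing on all naturals, so
  \<open>i \<le> w i\<close> everywhere, which forces a permutation of \<open>{1..n}\<close> to be
  the identity.\<close>

lemma exists_descent:
  assumes w: "w permutes {1..n}" and "w \<noteq> id"
  shows "\<exists>i\<in>{1..<n}. w (Suc i) < w i"
proof (rule ccontr)
  assume no: "\<not> ?thesis"
  have "w i < w (Suc i)" for i
  proof (cases "i \<in> {1..<n}")
    case True
    then show ?thesis
      using no permutes_interval_eq_iff[OF w, of i "Suc i"] by (meson linorder_neqE_nat n_not_Suc_n)
  next
    case False
    then have "\<not> w (Suc i) < w i" using inversion_bounds[OF w, of i "Suc i"] by auto
    then show ?thesis using permutes_interval_eq_iff[OF w, of i "Suc i"] by linarith
  qed
  then have "strict_mono w" by (simp add: strict_mono_Suc_iff)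
  then have "i \<le> w i" for i by (rule strict_mono_imp_increasing)
  then have "w = id" using permutes_natset_ge[OF w] by blast
  then show False using \<open>w \<noteq> id\<close> by simp
qed

section \<open>Coxeter length as number of inversions\<close>

lemma expression_snoc:
  assumes "expression n (w \<circ> gen i) r" "i \<in> {1..<n}"
  shows "expression n w (r @ [i])"
  using assms by (auto simp: expression_def word_prod_append)

text \<open>Bubble sort: cancelling a descent on the right removes exactly one inversion, until the
  identity is reached.\<close>

lemma exists_short_expression:
  "w permutes {1..n} \<Longrightarrow> \<exists>r. expression n w r \<and> length r = card (inversions w)"
proof (induction "card (inversions w)" arbitrary: w)
  case 0
  then have "w = id"
    using exists_descent[OF 0(2)] finite_inversions[OF 0(2)] by (force simp: inversions_def)
  then have "expression n w []" by (simp add: expression_def)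
  then show ?case using 0(1) by (intro exI[of _ "[]"]) simp
next
  case (Suc m)
  then have "w \<noteq> id" by (metis card.empty inversions_id nat.distinct(1))
  then obtain i where i: "i \<in> {1..<n}" "w (Suc i) < w i" using exists_descent Suc by blast
  have "card (inversions w) = Suc (card (inversions (w \<circ> gen i)))"
    by (rule card_inversions_descent[OF Suc(3) i])
  moreover have "w \<circ> gen i permutes {1..n}" using Suc i permutes_comp_gen by blast
  ultimately obtain r where "expression n (w \<circ> gen i) r" "length r = card (inversions (w \<circ> gen i))"
    using Suc by (metis Suc_inject)
  then show ?case
    using expression_snoc[OF _ i(1)] card_inversions_descent[OF Suc(3) i]
    by (intro exI[of _ "r @ [i]"]) auto
qed

lemma reduced_expression_iff:
  assumes "w permutes {1..n}"
  shows "reduced_expression n w r \<longleftrightarrow> expression n w r \<and> length r = card (inversions w)"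
  using exists_short_expression[OF assms] card_inversions_word_prod
  unfolding reduced_expression_def expression_def by (metis le_antisym)

lemma exists_reduced_expression: "w permutes {1..n} \<Longrightarrow> \<exists>r. reduced_expression n w r"
  using exists_short_expression reduced_expression_iff by blast

lemma reduced_expression_snoc:
  assumes "w permutes {1..n}" "i \<in> {1..<n}" "w (Suc i) < w i"
    and "reduced_expression n (w \<circ> gen i) r"
  shows "reduced_expression n w (r @ [i])"
  using assms card_inversions_descent[OF assms(1-3)] expression_snoc permutes_comp_gen
  by (simp add: reduced_expression_iff)

text \<open>The remaining prefix is too short for \<open>w \<circ> gen i\<close> to have more
  inversions than \<open>w\<close>, so the last letter is a descent. This allows induction on
  reduced words from the right.\<close>

lemma reduced_expression_snocD:
  assumes w: "w permutes {1..n}" and r: "reduced_expression n w (r @ [i])"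
  shows "i \<in> {1..<n}" "w (Suc i) < w i" "reduced_expression n (w \<circ> gen i) r"
proof -
  have e: "expression n w (r @ [i])" "length r + 1 = card (inversions w)"
    using r w by (auto simp: reduced_expression_iff)
  show i: "i \<in> {1..<n}" using e by (auto simp: expression_def)
  have w': "w \<circ> gen i permutes {1..n}" using w i by (rule permutes_comp_gen)
  have wr: "word_prod r = w \<circ> gen i"
    using e(1) by (auto simp: expression_def word_prod_append)
  then have er: "expression n (w \<circ> gen i) r" using e(1) by (auto simp: expression_def)
  then have le: "card (inversions (w \<circ> gen i)) \<le> length r"
    using card_inversions_word_prod[of r n] wr by (simp add: expression_def)
  show d: "w (Suc i) < w i"
  proof (rule ccontr)
    assume "\<not> ?thesis"
    then have "w i < w (Suc i)"
      using permutes_interval_eq_iff[OF w, of i "Suc i"] by linarith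
    then show False using card_inversions_ascent[OF w] le e(2) by fastforce
  qed
  show "reduced_expression n (w \<circ> gen i) r"
    using er e(2) card_inversions_descent[OF w i d] w' by (simp add: reduced_expression_iff)
qed

section \<open>Fully commutative elements avoid 321\<close>

definition contains_321 :: "(nat \<Rightarrow> nat) \<Rightarrow> bool" where
  "contains_321 w \<longleftrightarrow> (\<exists>a b c. a < b \<and> b < c \<and> w c < w b \<and> w b < w a)"

lemma contains_321I: "a < b \<Longrightarrow> b < c \<Longrightarrow> w c < w b \<Longrightarrow> w b < w a \<Longrightarrow> contains_321 w"
  by (auto simp: contains_321_def)

text \<open>A descent of \<open>w\<close> at \<open>i\<close> is an ascent of
  \<open>w \<circ> gen i\<close>, so no two entries of the pattern sit at \<open>i\<close> and
  \<open>Suc i\<close>, and \<open>gen i\<close> carries it to a pattern of \<open>w\<close>. Thus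
  avoidance passes to prefixes of reduced words.\<close>

lemma contains_321_comp_gen:
  assumes "w (Suc i) < w i" "contains_321 (w \<circ> gen i)"
  shows "contains_321 w"
proof -
  obtain a b c where abc: "a < b" "b < c" "w (gen i c) < w (gen i b)" "w (gen i b) < w (gen i a)"
    using assms by (auto simp: contains_321_def)
  have "a \<noteq> i \<or> b \<noteq> Suc i" "b \<noteq> i \<or> c \<noteq> Suc i" using abc assms(1) by auto
  then show ?thesis using abc by (intro contains_321I[of "gen i a" "gen i b" "gen i c"] gen_less)
qed

lemma descent_between:
  fixes w :: "nat \<Rightarrow> nat"
  assumes "a < b" "w b < w a"
  shows "\<exists>i. a \<le> i \<and> i < b \<and> w (Suc i) < w i"
proof (rule ccontr)
  assume no: "\<not> ?thesis"
  have "a \<le> k \<Longrightarrow> k \<le> b \<Longrightarrow> w a \<le> w k" for k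
  proof (induction k rule: dec_induct)
    case (step m)
    then show ?case using no by (meson Suc_le_lessD leI le_trans less_imp_le_nat)
  qed simp
  from this[of b] show False using assms by simp
qed

lemma braid: "gen i \<circ> gen (Suc i) \<circ> gen i = gen (Suc i) \<circ> gen i \<circ> gen (Suc i)"
  by (auto simp: gen_def transpose_def fun_eq_iff)

text \<open>
  Removing a descent that is not inside a given pattern 321 keeps the pattern. If there is no such
  descent, the pattern occupies three consecutive positions, and the braid relation
  applied there changes the number of occurrences of a generator.
\<close>

lemma contains_321_distinct_counts:
  assumes "w permutes {1..n}" "contains_321 w"
  shows "\<exists>r r' k. reduced_expression n w r \<and> reduced_expression n w r' \<and>
           count_list r k \<noteq> count_list r' k"
  using assms
proof (induction "card (inversions w)" arbitrary: w rule: less_induct)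
  case less
  note w = less.prems(1)
  obtain a b c where abc: "a < b" "b < c" "w c < w b" "w b < w a"
    using less.prems by (auto simp: contains_321_def)
  have pos: "w x < w y \<Longrightarrow> y < x \<Longrightarrow> 1 \<le> y \<and> x \<le> n" for x y
    using inversion_bounds[OF w] by blast
  show ?case
  proof (cases "\<exists>i. w (Suc i) < w i \<and> (a \<noteq> i \<or> b \<noteq> Suc i) \<and> (b \<noteq> i \<or> c \<noteq> Suc i)")
    case True
    then obtain i where i: "w (Suc i) < w i" "a \<noteq> i \<or> b \<noteq> Suc i" "b \<noteq> i \<or> c \<noteq> Suc i" by blast
    have iin: "i \<in> {1..<n}" using pos[OF i(1)] by simp
    have "contains_321 (w \<circ> gen i)"
      using abc i by (intro contains_321I[of "gen i a" "gen i b" "gen i c"] gen_less) simp_all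
    then obtain r r' k where "reduced_expression n (w \<circ> gen i) r"
      "reduced_expression n (w \<circ> gen i) r'" "count_list r k \<noteq> count_list r' k"
      using less.hyps[of "w \<circ> gen i"] card_inversions_descent[OF w iin i(1)]
        permutes_comp_gen[OF w iin] by auto
    then show ?thesis
      using reduced_expression_snoc[OF w iin i(1)]
      by (intro exI[of _ "r @ [i]"] exI[of _ "r' @ [i]"] exI[of _ k]) auto
  next
    case False
    \<comment> \<open>Every descent is now the pair \<open>a\<close>, \<open>b\<close> or the pair
      \<open>b\<close>, \<open>c\<close>; one starting in \<open>[a, b)\<close> can only be the
      former.\<close>
    have "b = Suc a" using descent_between[of a b w] abc False by force
    moreover have "c = Suc b" using descent_between[of b c w] abc False by force
    ultimately have bc: "b = Suc a" "c = Suc (Suc a)" by auto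
    have ain: "a \<in> {1..<n}" "Suc a \<in> {1..<n}" using pos[of b a] pos[of c b] abc bc by auto
    \<comment> \<open>\<open>?w\<close> has the three pattern values in increasing order. Either
      side of the braid relation leads back to \<open>w\<close> through descents only, using the
      letter \<open>a\<close> twice or once.\<close>
    let ?w = "w \<circ> gen a \<circ> gen (Suc a) \<circ> gen a"
    have eq: "?w = w \<circ> gen (Suc a) \<circ> gen a \<circ> gen (Suc a)"
      using braid[of a] by (metis comp_assoc)
    have oth: "gen a (Suc (Suc a)) = Suc (Suc a)" "gen (Suc a) a = a"
      by (simp_all add: gen_other)
    note P = permutes_comp_gen
    obtain r where r: "reduced_expression n ?w r"
      using exists_reduced_expression P w ain by metis
    have "reduced_expression n w (((r @ [a]) @ [Suc a]) @ [a])"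
      using r abc bc oth ain w P
      by (intro reduced_expression_snoc) auto
    moreover have "reduced_expression n w (((r @ [Suc a]) @ [a]) @ [Suc a])"
      using r[unfolded eq] abc bc oth ain w P
      by (intro reduced_expression_snoc) auto
    moreover have "count_list (((r @ [a]) @ [Suc a]) @ [a]) a
        \<noteq> count_list (((r @ [Suc a]) @ [a]) @ [Suc a]) a" by simp
    ultimately show ?thesis by blast
  qed
qed

lemma commutation_count_list: "commutation\<^sup>*\<^sup>* r r' \<Longrightarrow> count_list r k = count_list r' k"
  by (induction rule: rtranclp_induct) (auto elim!: commutation.cases)

text \<open>Commutations only permute letters, so they cannot connect two reduced words with
  different letter counts.\<close>

lemma fully_commutative_avoids_321:
  "w permutes {1..n} \<Longrightarrow> fully_commutative n w \<Longrightarrow> \<not> contains_321 w"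
  using contains_321_distinct_counts commutation_count_list
  unfolding fully_commutative_def by metis

section \<open>Heap heights\<close>

definition crossing :: "(nat \<Rightarrow> nat) \<Rightarrow> nat \<Rightarrow> nat set" where
  "crossing w k = {j. j \<le> k \<and> k < w j}"

lemma finite_crossing [simp]: "finite (crossing w k)"
  by (simp add: crossing_def)

text \<open>Pigeonhole. If \<open>w i \<le> i\<close>, avoidance bounds the values at positions
  \<open>1..Suc i\<close> by \<open>w i\<close>, so \<open>Suc i\<close> positions share
  \<open>i\<close> values. The other claim is symmetric, with positions \<open>i..n\<close> and
  values above \<open>i\<close>.\<close>

lemma descent_straddles:
  assumes w: "w permutes {1..n}" and av: "\<not> contains_321 w"
    and i: "i \<in> {1..<n}" and d: "w (Suc i) < w i"
  shows "w (Suc i) \<le> i" "i < w i"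
proof -
  have inn: "w x \<in> {1..n} \<longleftrightarrow> x \<in> {1..n}" for x using w by (rule permutes_in_image)
  have inj: "inj w" using w by (rule permutes_inj)
  show "i < w i"
  proof (rule ccontr)
    assume le: "\<not> i < w i"
    have "w ` {1..Suc i} \<subseteq> {1..i}"
    proof
      fix y assume "y \<in> w ` {1..Suc i}"
      then obtain j where j: "y = w j" "1 \<le> j" "j \<le> Suc i" by auto
      have "w j \<le> w i"
      proof (cases "j < i")
        case True
        then show ?thesis using av contains_321I[of j i "Suc i" w] d by fastforce
      next
        case False
        then have "j = i \<or> j = Suc i" using j by linarith
        then show ?thesis using d by auto
      qed
      then show "y \<in> {1..i}" using j le inn[of j] i by auto
    qed
    then have "card (w ` {1..Suc i}) \<le> card {1..i}" by (intro card_mono) auto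
    then show False using card_image[OF inj_on_subset[OF inj]] by simp
  qed
  show "w (Suc i) \<le> i"
  proof (rule ccontr)
    assume gt: "\<not> w (Suc i) \<le> i"
    have "w ` {i..n} \<subseteq> {Suc i..n}"
    proof
      fix y assume "y \<in> w ` {i..n}"
      then obtain j where j: "y = w j" "i \<le> j" "j \<le> n" by auto
      have "w (Suc i) \<le> w j"
      proof (cases "Suc i < j")
        case True
        then show ?thesis using av contains_321I[of i "Suc i" j w] d by fastforce
      next
        case False
        then have "j = i \<or> j = Suc i" using j by linarith
        then show ?thesis using d by auto
      qed
      then show "y \<in> {Suc i..n}" using j gt inn[of j] i by auto
    qed
    then have "card (w ` {i..n}) \<le> card {Suc i..n}" by (intro card_mono) auto
    then show False using card_image[OF inj_on_subset[OF inj], of "{i..n}"] i by auto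
  qed
qed

text \<open>For \<open>k \<noteq> i\<close>, \<open>gen i\<close> moves no position across the
  threshold \<open>k\<close>, so it is a bijection between the two sets.\<close>

lemma crossing_comp_gen_other:
  assumes "k \<noteq> i"
  shows "card (crossing (w \<circ> gen i) k) = card (crossing w k)"
proof (rule bij_betw_same_card[of "gen i"], rule bij_betw_byWitness[of _ "gen i"])
qed (use assms gen_le_iff in \<open>auto simp: crossing_def\<close>)

text \<open>Among the positions up to \<open>i\<close>, \<open>gen i\<close> moves only
  \<open>i\<close>, whose new value \<open>w (Suc i)\<close> no longer exceeds
  \<open>i\<close>.\<close>

lemma crossing_comp_gen_same:
  assumes "w (Suc i) \<le> i" "i < w i"
  shows "card (crossing w i) = Suc (card (crossing (w \<circ> gen i) i))"
proof -
  have "crossing w i = insert i (crossing (w \<circ> gen i) i)"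
    using assms by (auto simp: crossing_def gen_other) (metis gen_other gen_simps(1) Suc_n_not_le_n)+
  moreover have "i \<notin> crossing (w \<circ> gen i) i" using assms by (simp add: crossing_def)
  ultimately show ?thesis by simp
qed

text \<open>Deleting the last letter lowers both sides by one at that letter and leaves them
  unchanged elsewhere. The count is therefore the same for all reduced words, as
  \<open>occurrences\<close> requires.\<close>

lemma count_list_reduced_expression:
  assumes "w permutes {1..n}" "\<not> contains_321 w" "reduced_expression n w r"
  shows "count_list r k = card (crossing w k)"
  using assms
proof (induction r arbitrary: w rule: rev_induct)
  case Nil
  then have "w = id" by (simp add: reduced_expression_def expression_def)
  then have "crossing w k = {}" by (auto simp: crossing_def)
  then show ?case by simp
next
  case (snoc i r)
  note D = reduced_expression_snocD[OF snoc.prems(1,3)]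
  have IH: "count_list r k = card (crossing (w \<circ> gen i) k)"
    using snoc D permutes_comp_gen contains_321_comp_gen by metis
  show ?case
  proof (cases "k = i")
    case True
    then show ?thesis
      using IH crossing_comp_gen_same descent_straddles[OF snoc.prems(1,2) D(1,2)] by simp
  next
    case False
    then show ?thesis using IH crossing_comp_gen_other by simp
  qed
qed

lemma heap_height_eq:
  assumes w: "w permutes {1..n}" and av: "\<not> contains_321 w" and "k \<le> n"
  shows "heap_height n w k = card (crossing w k)"
proof (cases "1 \<le> k \<and> k < n")
  case True
  obtain r where r: "reduced_expression n w r" using exists_reduced_expression w by blast
  have "occurrences n w k = card (crossing w k)"
    unfolding occurrences_def
    using r count_list_reduced_expression[OF w av] by (intro the_equality) auto
  then show ?thesis using True by (simp add: heap_height_def)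
next
  case False
  have inn: "w x \<in> {1..n} \<longleftrightarrow> x \<in> {1..n}" for x using w by (rule permutes_in_image)
  have w0: "w 0 = 0" using w by (simp add: permutes_def)
  \<comment> \<open>Only the endpoints \<open>k = 0\<close> and \<open>k = n\<close> remain, where
    the height is 0 by convention; nothing crosses there because \<open>w\<close> fixes 0 and
    preserves \<open>{1..n}\<close>.\<close>
  have "crossing w k = {}"
  proof (cases "k = 0")
    case True
    then show ?thesis using w0 by (auto simp: crossing_def intro!: gr0I)
  next
    case False
    then have k: "k = n" using \<open>\<not> (1 \<le> k \<and> k < n)\<close> \<open>k \<le> n\<close> by auto
    have "\<not> (j \<le> n \<and> n < w j)" for j
      using inn[of j] w0 by (cases "j = 0") auto
    then show ?thesis using k by (auto simp: crossing_def)
  qed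
  then show ?thesis using False by (auto simp: heap_height_def)
qed

text \<open>Passing from \<open>i\<close> to \<open>Suc i\<close>, the position \<open>Suc i\<close>
  enters if its value is larger, and the position with value \<open>Suc i\<close> leaves if it is
  smaller. For an involution that position is \<open>w (Suc i)\<close>, so at most one of the two
  happens.\<close>

lemma card_crossing_Suc:
  assumes inv: "w \<circ> w = id"
  shows "int (card (crossing w (Suc i))) - int (card (crossing w i)) =
    (if Suc i < w (Suc i) then 1 else if w (Suc i) < Suc i then -1 else 0)"
proof -
  have ww: "w (w x) = x" for x using inv by (metis comp_apply id_apply)
  let ?m = "Suc i"
  have key: "i < w j \<longleftrightarrow> ?m < w j \<or> j = w ?m" for j
    using ww by (metis Suc_lessI lessI less_trans)
  consider "?m < w ?m" | "w ?m < ?m" | "w ?m = ?m" by linarith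
  then show ?thesis
  proof cases
    case 1
    then have "crossing w ?m = insert ?m (crossing w i)"
      by (auto simp: crossing_def le_Suc_eq key)
    moreover have "?m \<notin> crossing w i" by (simp add: crossing_def)
    ultimately show ?thesis using 1 by simp
  next
    case 2
    then have "crossing w i = insert (w ?m) (crossing w ?m)"
      by (auto simp: crossing_def le_Suc_eq key)
    moreover have "w ?m \<notin> crossing w ?m" using ww by (simp add: crossing_def)
    ultimately show ?thesis using 2 by simp
  next
    case 3
    then have "crossing w i = crossing w ?m"
      by (auto simp: crossing_def le_Suc_eq key)
    then show ?thesis using 3 by simp
  qed
qed

section \<open>The insertion tableau\<close>

lemma row_insert_append: "\<forall>y\<in>set r. y < x \<Longrightarrow> row_insert x r = (r @ [x], None)"
  by (induction r) auto

text \<open>The hypotheses make \<open>y\<close> the least entry above \<open>x\<close> and keep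
  \<open>x\<close> out of the row, so the row stays strictly increasing.\<close>

lemma row_insert_bump:
  assumes "sorted_wrt (<) r" "y \<in> set r" "x < y" "\<forall>z\<in>set r. z < x \<or> y \<le> z"
  shows "\<exists>r'. row_insert x r = (r', Some y) \<and> sorted_wrt (<) r' \<and>
           set r' = insert x (set r - {y})"
  using assms
proof (induction r)
  case (Cons a r)
  show ?case
  proof (cases "x < a")
    case True
    then have "a = y" using Cons.prems by (auto simp: le_less_Suc_eq)
    then show ?thesis using Cons.prems True by auto
  next
    case False
    then have "a < x" "a \<noteq> y" using Cons.prems by auto
    then obtain r' where "row_insert x r = (r', Some y)" "sorted_wrt (<) r'"
      "set r' = insert x (set r - {y})" using Cons by auto
    then show ?thesis using False \<open>a < x\<close> \<open>a \<noteq> y\<close> Cons.prems(1) by auto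
  qed
qed simp

text \<open>A strictly increasing row is determined by its set of entries, so sets suffice to
  describe the tableau. The case distinction reflects that a tableau stores no empty rows.\<close>

definition two_rows :: "nat list list \<Rightarrow> nat set \<Rightarrow> nat set \<Rightarrow> bool" where
  "two_rows T A B \<longleftrightarrow> (\<exists>r s. sorted_wrt (<) r \<and> sorted_wrt (<) s \<and> set r = A \<and> set s = B \<and>
     (r = [] \<longrightarrow> s = []) \<and> T = (if r = [] then [] else if s = [] then [r] else [r, s]))"

lemma two_rows_append:
  assumes "two_rows T A B" "\<forall>a\<in>A. a < x"
  shows "two_rows (tableau_insert x T) (insert x A) B"
proof -
  obtain r s where "sorted_wrt (<) r" "sorted_wrt (<) s" "set r = A" "set s = B"
    "r = [] \<longrightarrow> s = []" "T = (if r = [] then [] else if s = [] then [r] else [r, s])"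
    using assms(1) by (auto simp: two_rows_def)
  then show ?thesis
    using assms(2) row_insert_append[of r x] unfolding two_rows_def
    by (intro exI[of _ "r @ [x]"] exI[of _ s]) (auto simp: sorted_wrt_append)
qed

text \<open>The bumped entry exceeds the whole second row, so it is appended there and no third row
  starts.\<close>

lemma two_rows_bump:
  assumes "two_rows T A B" "y \<in> A" "x < y" "\<forall>a\<in>A. a < x \<or> y \<le> a" "\<forall>b\<in>B. b < y"
  shows "two_rows (tableau_insert x T) (insert x (A - {y})) (insert y B)"
proof -
  obtain r s where rs: "sorted_wrt (<) r" "sorted_wrt (<) s" "set r = A" "set s = B"
    "r = [] \<longrightarrow> s = []" "T = (if r = [] then [] else if s = [] then [r] else [r, s])"
    using assms(1) by (auto simp: two_rows_def)
  obtain r' where r': "row_insert x r = (r', Some y)" "sorted_wrt (<) r'"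
    "set r' = insert x (A - {y})"
    using row_insert_bump[of r y x] rs assms by auto
  have "row_insert y s = (s @ [y], None)" using row_insert_append rs assms by auto
  moreover have ne: "r \<noteq> []" "r' \<noteq> []" using rs r' assms by auto
  ultimately have "tableau_insert x T = [r', s @ [y]]"
    using rs(6) r'(1) by (cases "s = []") simp_all
  moreover have "sorted_wrt (<) (s @ [y])" "set (s @ [y]) = insert y B"
    using rs assms(5) by (auto simp: sorted_wrt_append)
  ultimately show ?thesis
    using r' ne unfolding two_rows_def
    by (intro exI[of _ r'] exI[of _ "s @ [y]"]) simp
qed

text \<open>
  A deficient position i (one with w(i) < i) inserts w(i), and the entry it bumps is i itself:
  avoidance of 321 leaves no entry of the first row between w(i) and i.
\<close>

lemma two_rows_insertion:
  assumes inv: "w \<circ> w = id" and av: "\<not> contains_321 w" and w0: "w 0 = 0"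
  shows "two_rows (fold tableau_insert (map w [1..<Suc i]) [])
           (w ` {1..i} - {v. v \<le> i \<and> w v < v}) {v. v \<le> i \<and> w v < v}"
proof (induction i)
  case 0
  show ?case using w0 by (auto simp: two_rows_def intro!: exI[of _ "[]"])
next
  case (Suc i)
  have ww: "w (w x) = x" for x using inv by (metis comp_apply id_apply)
  let ?R = "\<lambda>i. {v. v \<le> i \<and> w v < v}" and ?m = "Suc i"
  let ?T = "fold tableau_insert (map w [1..<Suc i]) []"
  have T: "fold tableau_insert (map w [1..<Suc ?m]) [] = tableau_insert (w ?m) ?T" by simp
  have im: "w ` {1..?m} = insert (w ?m) (w ` {1..i})" by (simp add: atLeastAtMostSuc_conv)
  show ?case
  proof (cases "w ?m < ?m")
    case False
    have "w j < w ?m" if j: "j \<le> i" for j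
    proof (rule ccontr)
      assume "\<not> w j < w ?m"
      then have gt: "w ?m < w j" using ww[of j] ww[of ?m] j by (metis Suc_n_not_le_n linorder_neqE_nat)
      \<comment> \<open>The pattern starts at \<open>j\<close> and \<open>?m\<close>. Its third
        position is \<open>w j\<close> with value \<open>j\<close> if \<open>?m\<close> is fixed,
        and otherwise \<open>w ?m\<close> with value \<open>?m\<close>.\<close>
      have "contains_321 w"
      proof (cases "w ?m = ?m")
        case True
        then show ?thesis using contains_321I[of j ?m "w j" w] gt j ww by auto
      next
        case neq: False
        then show ?thesis using contains_321I[of j ?m "w ?m" w] gt j ww False by auto
      qed
      then show False using av by simp
    qed
    then have "two_rows (tableau_insert (w ?m) ?T) (insert (w ?m) (w ` {1..i} - ?R i)) (?R i)"
      using Suc by (intro two_rows_append) auto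
    moreover have R: "?R ?m = ?R i" using False by (auto simp: le_Suc_eq)
    moreover have "w ?m \<notin> ?R i" using False ww by auto
    then have "insert (w ?m) (w ` {1..i}) - ?R i = insert (w ?m) (w ` {1..i} - ?R i)" by blast
    ultimately show ?thesis unfolding T im R by (simp only:)
  next
    case True
    have pos: "w ?m \<noteq> 0" using ww[of ?m] w0 by (metis nat.distinct(1))
    \<comment> \<open>The value \<open>?m\<close> was inserted earlier, at position
      \<open>w ?m\<close>, which lies in \<open>{1..i}\<close>.\<close>
    have "?m \<in> w ` {1..i} - ?R i"
      using True pos ww[of ?m] by (auto simp: image_iff intro!: bexI[of _ "w ?m"])
    moreover have "a < w ?m \<or> ?m \<le> a" if a: "a \<in> w ` {1..i} - ?R i" for a
    proof (rule ccontr)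
      assume "\<not> ?thesis"
      then have lt: "w ?m \<le> a" "a < ?m" by auto
      obtain j where j: "a = w j" "j \<le> i" using a by auto
      have "a \<noteq> w ?m" using j ww[of j] ww[of ?m] by (metis Suc_n_not_le_n)
      moreover have "a \<le> j" using a lt(2) j ww by auto
      ultimately have "contains_321 w"
        using contains_321I[of "w ?m" a ?m w] j lt ww by auto
      then show False using av by simp
    qed
    ultimately have "two_rows (tableau_insert (w ?m) ?T)
        (insert (w ?m) (w ` {1..i} - ?R i - {?m})) (insert ?m (?R i))"
      using Suc True by (intro two_rows_bump) auto
    moreover have R: "?R ?m = insert ?m (?R i)" using True by (auto simp: le_Suc_eq)
    moreover have "w ?m \<notin> insert ?m (?R i)" using True ww by auto
    then have "insert (w ?m) (w ` {1..i}) - insert ?m (?R i) =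
        insert (w ?m) (w ` {1..i} - ?R i - {?m})"
      by (simp only: insert_Diff_if if_False Diff_insert[symmetric])
    ultimately show ?thesis unfolding T im R by (simp only:)
  qed
qed

lemma two_rows_in_row:
  assumes "two_rows T A B"
  shows "in_row T 1 i \<longleftrightarrow> i \<in> A" "in_row T 2 i \<longleftrightarrow> i \<in> B"
  using assms by (auto simp: two_rows_def in_row_def split: if_splits)

text \<open>After all insertions the two rows partition \<open>{1..n}\<close>, so the
  \<open>undefined\<close> branch of \<open>beta_step\<close> is never reached.\<close>

lemma beta_step_eq:
  assumes w: "w permutes {1..n}" and inv: "w \<circ> w = id" and av: "\<not> contains_321 w"
    and i: "i \<in> {1..n}"
  shows "beta_step n w i = (1, if w i < i then -1 else 1)"
proof -
  have "w 0 = 0" using w by (simp add: permutes_def)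
  note two_rows_insertion[OF inv av this, of n, folded RS_tableau_def]
  note R = two_rows_in_row[OF this]
  have "w ` {1..n} = {1..n}" using w by (rule permutes_image)
  then show ?thesis using i unfolding beta_step_def R by auto
qed

section \<open>Comparison of the two walks\<close>

lemma walk_steps_map_upt:
  "walk_steps (map p [0..<Suc n]) = map (\<lambda>i. p (Suc i) - p i) [0..<n]"
proof -
  have "butlast (map p [0..<Suc n]) = map p [0..<n]" by simp
  moreover have "tl (map p [0..<Suc n]) = map p (map Suc [0..<n])"
    by (simp only: map_Suc_upt map_tl[symmetric] tl_upt)
  ultimately show ?thesis
    unfolding walk_steps_def by (intro nth_equalityI) auto
qed

theorem proposition2p4:
  fixes n :: nat and w :: "nat \<Rightarrow> nat"
  assumes "1 \<le> n"
    and "w permutes {1..n}"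
    and "fully_commutative n w"
    and "w \<circ> w = id"
  shows "beta_walk n w = replace_horizontal_by_ascending (gamma_walk n w)"
proof -
  have av: "\<not> contains_321 w" using assms fully_commutative_avoids_321 by blast
  let ?p = "\<lambda>i. (int i, int (heap_height n w i))"
  let ?f = "\<lambda>s :: int \<times> int. if s = (1, 0) then (1, 1) else s"
  \<comment> \<open>Both steps depend only on how \<open>w (Suc i)\<close> compares with
    \<open>Suc i\<close>; they differ just at fixed points, where \<open>?f\<close> turns the
    horizontal step into an ascending one.\<close>
  have "beta_step n w (Suc i) = ?f (?p (Suc i) - ?p i)" if "i < n" for i
    using that heap_height_eq[OF assms(2) av, of i] heap_height_eq[OF assms(2) av, of "Suc i"]
      card_crossing_Suc[OF assms(4), of i] beta_step_eq[OF assms(2,4) av, of "Suc i"]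
    by auto
  moreover have "map (beta_step n w) [1..<Suc n] = map (\<lambda>i. beta_step n w (Suc i)) [0..<n]"
    by (simp only: One_nat_def map_Suc_upt[symmetric] map_map o_def)
  ultimately have "map (beta_step n w) [1..<Suc n] = map ?f (walk_steps (gamma_walk n w))"
    unfolding gamma_walk_def walk_steps_map_upt by simp
  moreover have "hd (gamma_walk n w) = (0, 0)"
    by (simp add: gamma_walk_def hd_map heap_height_def del: upt_Suc)
  ultimately show ?thesis
    by (simp add: beta_walk_def replace_horizontal_by_ascending_def)
qed

end
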